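(* Let $\mathcal{T}$ be an $\mathcal{EL}^{+}$ TBox in normal form, let $\mathcal{T}'\subseteq\mathcal{T}$, and let $C,D$ be concept names occurring in $\mathcal{T}$ (or $\top$). Let $\phi^{all}_{\mathcal{T}(po)}$ be the pinpointing Horn formula of $\mathcal{T}$ described in the context. Then $\mathcal{T}'$ is a MinA for $C\sqsubseteq D$ (i.e. $C\sqsubseteq_{\mathcal{T}'}D$ and $C\not\sqsubseteq_{\mathcal{T}''}D$ for every $\mathcal{T}''\subsetneq\mathcal{T}'$) if and only if the Horn propositional formula $$\phi^{all}_{\mathcal{T}(po)}\;\wedge\;\bigwedge_{ax_i\in\mathcal{T}'}s_{[ax_i]}\;\wedge\;\neg s_{[C\sqsubseteq D]}$$ is minimally unsatisfiable, in the sense that it is unsatisfiable, while for every $ax_j\in\mathcal{T}'$ the formula obtained by deleting the unit clause $s_{[ax_j]}$ (keeping all clauses of $\phi^{all}_{\mathcal{T}(po)}$ and the clause $\neg s_{[C\sqsubseteq D]}$) is satisfiable.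
   Context: $\mathcal{EL}^{+}$: concepts are built from concept names and $\top$ using conjunction $X\sqcap Y$ and existential restriction $\exists r.X$ ($r$ a role name); an interpretation $(\Delta^I,\cdot^I)$ maps concept names to subsets of $\Delta^I$ and role names to binary relations, with $\top^I=\Delta^I$, $(X\sqcap Y)^I=X^I\cap Y^I$, $(\exists r.X)^I=\{x\mid \exists y:(x,y)\in r^I, y\in X^I\}$. A TBox is a finite set of general concept inclusions $X\sqsubseteq Y$ (satisfied if $X^I\subseteq Y^I$) and role inclusions $r_1\circ\cdots\circ r_n\sqsubseteq s$ (satisfied if $r_1^I\circ\cdots\circ r_n^I\subseteq s^I$). $C\sqsubseteq_{\mathcal{T}}D$ means $C^I\subseteq D^I$ in every model $I$ of $\mathcal{T}$. Normal form: every GCI has one of the forms $C_1\sqcap\cdots\sqcap C_k\sqsubseteq D$ ($k\ge1$), $C\sqsubseteq\exists r.D$, $\exists r.C\sqsubseteq D$, with $C_i,C,D$ concept names or $\top$, and every RI is $r_1\circ\cdots\circ r_n\sqsubseteq s$ ($n\ge 1$). The classification algorithm derives assertions (GCIs of the form $C\sqsubseteq D$ or $C\sqsubseteq\exists r.D$ between concept names/$\top$ of $\mathcal{T}$), starting from the axioms of $\mathcal{T}$ and the trivial assertions $C\sqsubseteq C$, $C\sqsubseteq\top$, using the rules: (1) from $C\sqsubseteq C_1,\dots,C\sqsubseteq C_k$ and $C_1\sqcap\cdots\sqcap C_k\sqsubseteq D$ derive $C\sqsubseteq D$; (2) from $C\sqsubseteq C'$ and $C'\sqsubseteq\exists r.D$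 derive $C\sqsubseteq\exists r.D$; (3) from $C\sqsubseteq\exists r.E$, $E\sqsubseteq C'$ and $\exists r.C'\sqsubseteq D$ derive $C\sqsubseteq D$; (4) from $C_0\sqsubseteq\exists r_1.C_1,\dots,C_{n-1}\sqsubseteq\exists r_n.C_n$ and $r_1\circ\cdots\circ r_n\sqsubseteq s$ derive $C_0\sqsubseteq\exists s.C_n$. The formula $\phi^{all}_{\mathcal{T}(po)}$: introduce a Boolean selector variable $s_{[a]}$ for each axiom of $\mathcal{T}$ (GCI or RI) and each derived assertion $a$, where $s_{[a]}$ is the constant true for trivial assertions $C\sqsubseteq C$, $C\sqsubseteq\top$; for every application $r$ of a rule during classification (each distinct rule application considered once), with premises $\mathrm{antec}(r)$ and conclusion $a_i$, add the Horn clause $\big(\bigwedge_{a_j\in\mathrm{antec}(r)}s_{[a_j]}\big)\to s_{[a_i]}$. The variable $s_{[C\sqsubseteq D]}$ is the selector of the assertion $C\sqsubseteq D$. *)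

theory Defs
  imports Main "HOL-Library.Countable_Set" "HOL-Library.Infinite_Set"
begin

datatype (names_concept: 'c, roles_concept: 'r) concept =
    Top
  | Name 'c
  | Conj "('c, 'r) concept" "('c, 'r) concept"
  | Ex 'r "('c, 'r) concept"

datatype (names_axiom: 'c, roles_axiom: 'r) "axiom" =
    GCI "('c, 'r) concept" "('c, 'r) concept"
  | RI "'r list" 'r

record ('d, 'c, 'r) interp =
  Delta :: "'d set"
  cint :: "'c \<Rightarrow> 'd set"
  rint :: "'r \<Rightarrow> 'd rel"

definition is_interp :: "('d, 'c, 'r) interp \<Rightarrow> bool" where
  "is_interp I \<longleftrightarrow> Delta I \<noteq> {} \<and> (\<forall>A. cint I A \<subseteq> Delta I) \<and> (\<forall>r. rint I r \<subseteq> Delta I \<times> Delta I)"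

primrec conc :: "('d, 'c, 'r) interp \<Rightarrow> ('c, 'r) concept \<Rightarrow> 'd set" where
  "conc I Top = Delta I"
| "conc I (Name A) = cint I A"
| "conc I (Conj X Y) = conc I X \<inter> conc I Y"
| "conc I (Ex r X) = {x. \<exists>y. (x, y) \<in> rint I r \<and> y \<in> conc I X}"

text \<open>The empty chain only occurs as the neutral element of the recursion:
  normal-form role inclusions have a nonempty left-hand side.\<close>

primrec chain :: "('d, 'c, 'r) interp \<Rightarrow> 'r list \<Rightarrow> 'd rel" where
  "chain I [] = Id_on (Delta I)"
| "chain I (r # rs) = rint I r O chain I rs"

primrec satisfies :: "('d, 'c, 'r) interp \<Rightarrow> ('c, 'r) axiom \<Rightarrow> bool" where
  "satisfies I (GCI X Y) \<longleftrightarrow> conc I X \<subseteq> conc I Y"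
| "satisfies I (RI rs s) \<longleftrightarrow> chain I rs \<subseteq> rint I s"

definition is_model :: "('d, 'c, 'r) interp \<Rightarrow> ('c, 'r) axiom set \<Rightarrow> bool" where
  "is_model I T \<longleftrightarrow> is_interp I \<and> (\<forall>a\<in>T. satisfies I a)"

text \<open>HOL cannot quantify over all types, so subsumption is relative to the type \<open>'d\<close> the
  domains are taken from (the domains themselves are arbitrary nonempty subsets of it).  By
  \<open>subsumed_any_domain\<close> below, all infinite types give the same, unrestricted, relation.\<close>

definition subsumed ::
  "'d itself \<Rightarrow> ('c, 'r) axiom set \<Rightarrow> ('c, 'r) concept \<Rightarrow> ('c, 'r) concept \<Rightarrow> bool" where
  "subsumed _ T X Y \<longleftrightarrow> (\<forall>I :: ('d, 'c, 'r) interp. is_model I T \<longrightarrow> conc I X \<subseteq> conc I Y)"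

definition is_MinA ::
  "'d itself \<Rightarrow> ('c, 'r) axiom set \<Rightarrow> ('c, 'r) concept \<Rightarrow> ('c, 'r) concept \<Rightarrow> bool" where
  "is_MinA d T' X Y \<longleftrightarrow> subsumed d T' X Y \<and> (\<forall>T''. T'' \<subset> T' \<longrightarrow> \<not> subsumed d T'' X Y)"

definition is_atom :: "('c, 'r) concept \<Rightarrow> bool" where
  "is_atom X \<longleftrightarrow> X = Top \<or> (\<exists>A. X = Name A)"

text \<open>\<open>C\<^sub>1 \<sqinter> \<dots> \<sqinter> C\<^sub>k\<close> is a nested binary conjunction, with any bracketing.\<close>

fun conjuncts :: "('c, 'r) concept \<Rightarrow> ('c, 'r) concept list" where
  "conjuncts (Conj X Y) = conjuncts X @ conjuncts Y"
| "conjuncts X = [X]"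

definition atom_conj :: "('c, 'r) concept \<Rightarrow> bool" where
  "atom_conj X \<longleftrightarrow> (\<forall>Z\<in>set (conjuncts X). is_atom Z)"

primrec normal_axiom :: "('c, 'r) axiom \<Rightarrow> bool" where
  "normal_axiom (GCI X Y) \<longleftrightarrow>
      atom_conj X \<and> is_atom Y
    \<or> is_atom X \<and> (\<exists>r D. is_atom D \<and> Y = Ex r D)
    \<or> (\<exists>r C. is_atom C \<and> X = Ex r C) \<and> is_atom Y"
| "normal_axiom (RI rs s) \<longleftrightarrow> rs \<noteq> []"

definition normal_TBox :: "('c, 'r) axiom set \<Rightarrow> bool" where
  "normal_TBox T \<longleftrightarrow> finite T \<and> (\<forall>a\<in>T. normal_axiom a)"

definition atoms :: "('c, 'r) axiom set \<Rightarrow> ('c, 'r) concept set" where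
  "atoms T = insert Top (Name ` (\<Union>a\<in>T. names_axiom a))"

definition trivial :: "('c, 'r) axiom set \<Rightarrow> ('c, 'r) axiom set" where
  "trivial T = (\<lambda>C. GCI C C) ` atoms T \<union> (\<lambda>C. GCI C Top) ` atoms T"

text \<open>\<open>rule T as a\<close>: an instance of a completion rule with list of premises \<open>as\<close> and
  conclusion \<open>a\<close>.  The last premise is an axiom of \<open>T\<close>, the others are assertions.\<close>

inductive rule ::
  "('c, 'r) axiom set \<Rightarrow> ('c, 'r) axiom list \<Rightarrow> ('c, 'r) axiom \<Rightarrow> bool" for T where
  conj: "\<lbrakk>C \<in> atoms T; GCI X D \<in> T; atom_conj X; is_atom D\<rbrakk>
    \<Longrightarrow> rule T (map (GCI C) (conjuncts X) @ [GCI X D]) (GCI C D)"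
| ex_right: "\<lbrakk>C \<in> atoms T; C' \<in> atoms T; D \<in> atoms T; GCI C' (Ex r D) \<in> T\<rbrakk>
    \<Longrightarrow> rule T [GCI C C', GCI C' (Ex r D)] (GCI C (Ex r D))"
| ex_left: "\<lbrakk>C \<in> atoms T; E \<in> atoms T; C' \<in> atoms T; D \<in> atoms T; GCI (Ex r C') D \<in> T\<rbrakk>
    \<Longrightarrow> rule T [GCI C (Ex r E), GCI E C', GCI (Ex r C') D] (GCI C D)"
| role: "\<lbrakk>length Cs = Suc (length rs); set Cs \<subseteq> atoms T; RI rs s \<in> T\<rbrakk>
    \<Longrightarrow> rule T (map (\<lambda>i. GCI (Cs ! i) (Ex (rs ! i) (Cs ! Suc i))) [0..<length rs] @ [RI rs s])
          (GCI (Cs ! 0) (Ex s (Cs ! length rs)))"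

text \<open>The axioms of \<open>T\<close> together with everything the classification derives.\<close>

inductive_set derived :: "('c, 'r) axiom set \<Rightarrow> ('c, 'r) axiom set" for T where
  "a \<in> T \<Longrightarrow> a \<in> derived T"
| "a \<in> trivial T \<Longrightarrow> a \<in> derived T"
| "\<lbrakk>rule T as a; \<forall>b\<in>set as. b \<in> derived T\<rbrakk> \<Longrightarrow> a \<in> derived T"

datatype 'v pform =
    PTrue
  | PVar 'v
  | PNot "'v pform"
  | PAnd "'v pform" "'v pform"
  | PImp "'v pform" "'v pform"

primrec holds :: "('v \<Rightarrow> bool) \<Rightarrow> 'v pform \<Rightarrow> bool" where
  "holds v PTrue \<longleftrightarrow> True"
| "holds v (PVar x) \<longleftrightarrow> v x"
| "holds v (PNot F) \<longleftrightarrow> \<not> holds v F"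
| "holds v (PAnd F G) \<longleftrightarrow> holds v F \<and> holds v G"
| "holds v (PImp F G) \<longleftrightarrow> (holds v F \<longrightarrow> holds v G)"

text \<open>A set of formulas stands for the conjunction of its members.\<close>

definition satisfiable :: "'v pform set \<Rightarrow> bool" where
  "satisfiable \<Phi> \<longleftrightarrow> (\<exists>v. \<forall>F\<in>\<Phi>. holds v F)"

text \<open>Selector variables are named by the axioms and assertions themselves, so an axiom
  \<open>C \<sqsubseteq> D\<close> or \<open>C \<sqsubseteq> \<exists>r.D\<close> shares its selector with the equal assertion.\<close>

definition sel :: "('c, 'r) axiom set \<Rightarrow> ('c, 'r) axiom \<Rightarrow> ('c, 'r) axiom pform" where
  "sel T a = (if a \<in> trivial T then PTrue else PVar a)"

definition phi_all :: "('c, 'r) axiom set \<Rightarrow> ('c, 'r) axiom pform set" where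
  "phi_all T = {PImp (foldr PAnd (map (sel T) as) PTrue) (sel T a) | as a.
     rule T as a \<and> set as \<subseteq> derived T}"

definition pinpoint ::
  "('c, 'r) axiom set \<Rightarrow> ('c, 'r) axiom set \<Rightarrow> ('c, 'r) concept \<Rightarrow> ('c, 'r) concept \<Rightarrow>
    ('c, 'r) axiom pform set" where
  "pinpoint T T' C D = phi_all T \<union> sel T ` T' \<union> {PNot (sel T (GCI C D))}"

text \<open>Only the unit clauses of \<open>T'\<close> are candidates for deletion.\<close>

definition pinpoint_min_unsat ::
  "('c, 'r) axiom set \<Rightarrow> ('c, 'r) axiom set \<Rightarrow> ('c, 'r) concept \<Rightarrow> ('c, 'r) concept \<Rightarrow> bool" where
  "pinpoint_min_unsat T T' C D \<longleftrightarrow>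
     \<not> satisfiable (pinpoint T T' C D) \<and> (\<forall>ax\<in>T'. satisfiable (pinpoint T (T' - {ax}) C D))"


primrec subconcepts :: "('c, 'r) concept \<Rightarrow> ('c, 'r) concept set" where
  "subconcepts Top = {Top}"
| "subconcepts (Name A) = {Name A}"
| "subconcepts (Conj X Y) = insert (Conj X Y) (subconcepts X \<union> subconcepts Y)"
| "subconcepts (Ex r X) = insert (Ex r X) (subconcepts X)"

primrec axiom_subconcepts :: "('c, 'r) axiom \<Rightarrow> ('c, 'r) concept set" where
  "axiom_subconcepts (GCI X Y) = subconcepts X \<union> subconcepts Y"
| "axiom_subconcepts (RI rs s) = {}"

lemma finite_subconcepts: "finite (subconcepts X)"
  by (induction X) auto

lemma finite_axiom_subconcepts: "finite (axiom_subconcepts a)"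
  by (cases a) (auto simp: finite_subconcepts)

lemma self_subconcepts: "X \<in> subconcepts X"
  by (cases X) auto

fun wit :: "('d, 'c, 'r) interp \<Rightarrow> ('c, 'r) concept \<Rightarrow> 'd \<Rightarrow> 'd" where
  "wit I (Ex r X) y =
     (if y \<in> conc I (Ex r X) then (SOME z. (y, z) \<in> rint I r \<and> z \<in> conc I X) else y)"
| "wit I _ y = y"

text \<open>Downward Loewenheim-Skolem: a countermodel over any type \<open>'e\<close> has a countable submodel
  that is still a countermodel, and it embeds into any infinite type \<open>'d\<close>.\<close>

lemma subsumed_any_domain:
  fixes I :: "('e, 'c, 'r) interp" and T :: "('c, 'r) axiom set"
  assumes inf: "infinite (UNIV :: 'd set)" and fin: "finite T"
    and sub: "subsumed TYPE('d) T X Y" and I: "is_model I T"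
  shows "conc I X \<subseteq> conc I Y"
proof
  fix x assume x: "x \<in> conc I X"
  define S where "S = subconcepts X \<union> subconcepts Y \<union> (\<Union>a\<in>T. axiom_subconcepts a)"
  have "finite S" unfolding S_def using fin
    by (auto simp: finite_subconcepts finite_axiom_subconcepts)
  define W where "W = (\<lambda>l. fold (wit I) l x) ` lists S"
  have "countable W" unfolding W_def
    using \<open>finite S\<close> by (intro countable_image countable_lists countable_finite)
  have wf: "is_interp I" using I by (simp add: is_model_def)
  have sub_Delta: "conc I Z \<subseteq> Delta I" for Z
    using wf by (induction Z) (auto simp: is_interp_def)
  have wit_ex: "(y, wit I (Ex r Z) y) \<in> rint I r \<and> wit I (Ex r Z) y \<in> conc I Z"
    if "y \<in> conc I (Ex r Z)" for y r Z
  proof -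
    have "\<exists>z. (y, z) \<in> rint I r \<and> z \<in> conc I Z" using that by simp
    from someI_ex[OF this] show ?thesis using that by simp
  qed
  have wit_Delta: "wit I Z y \<in> Delta I" if "y \<in> Delta I" for Z y
  proof (cases "\<exists>r Z'. Z = Ex r Z' \<and> y \<in> conc I (Ex r Z')")
    case True
    then show ?thesis using wit_ex sub_Delta by blast
  next
    case False
    then show ?thesis using that by (cases Z) auto
  qed
  have "fold (wit I) l y \<in> Delta I" if "y \<in> Delta I" for l y
    using that by (induction l arbitrary: y) (auto simp: wit_Delta)
  then have W_Delta: "W \<subseteq> Delta I" unfolding W_def using x sub_Delta by blast
  have xW: "x \<in> W" unfolding W_def by (rule image_eqI[of _ _ "[]"]) auto
  have W_wit: "wit I Z y \<in> W" if yW: "y \<in> W" and "Z \<in> S" for y Z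
  proof -
    obtain l where l: "l \<in> lists S" "y = fold (wit I) l x" using yW unfolding W_def by auto
    show ?thesis unfolding W_def
      by (rule image_eqI[of _ _ "l @ [Z]"]) (use l \<open>Z \<in> S\<close> in auto)
  qed
  obtain h :: "nat \<Rightarrow> 'd" where h: "inj h"
    using infinite_countable_subset[OF inf] by auto
  define g where "g = h \<circ> to_nat_on W"
  have g: "inj_on g W" unfolding g_def
    using \<open>countable W\<close> h by (meson comp_inj_on inj_on_to_nat_on inj_on_subset subset_UNIV)
  define J :: "('d, 'c, 'r) interp" where
    "J = \<lparr>Delta = g ` W, cint = (\<lambda>A. g ` (cint I A \<inter> W)),
          rint = (\<lambda>r. map_prod g g ` (rint I r \<inter> W \<times> W))\<rparr>"
  have concJ: "conc J Z = g ` (conc I Z \<inter> W)" if "subconcepts Z \<subseteq> S" for Z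
    using that
  proof (induction Z)
    case Top
    then show ?case using W_Delta by (auto simp: J_def)
  next
    case (Name A)
    then show ?case by (simp add: J_def)
  next
    case (Conj Z1 Z2)
    then have IH: "conc J Z1 = g ` (conc I Z1 \<inter> W)" "conc J Z2 = g ` (conc I Z2 \<inter> W)" by auto
    show ?case unfolding conc.simps IH
      using inj_on_image_Int[OF g, of "conc I Z1 \<inter> W" "conc I Z2 \<inter> W"]
      by (simp add: inf_commute inf_left_commute)
  next
    case (Ex r Z)
    then have IH: "conc J Z = g ` (conc I Z \<inter> W)" and S: "Ex r Z \<in> S" by auto
    show ?case
    proof (intro set_eqI iffI)
      fix u assume "u \<in> conc J (Ex r Z)"
      then obtain w where w: "(u, w) \<in> rint J r" "w \<in> g ` (conc I Z \<inter> W)" using IH by auto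
      then obtain a b where ab: "(a, b) \<in> rint I r" "a \<in> W" "b \<in> W" "u = g a" "w = g b"
        by (auto simp: J_def)
      then have "b \<in> conc I Z" using w(2) g by (auto simp: inj_on_def)
      then show "u \<in> g ` (conc I (Ex r Z) \<inter> W)" using ab by auto
    next
      fix u assume "u \<in> g ` (conc I (Ex r Z) \<inter> W)"
      then obtain a where a: "a \<in> conc I (Ex r Z)" "a \<in> W" "u = g a" by blast
      let ?b = "wit I (Ex r Z) a"
      have b: "(a, ?b) \<in> rint I r" "?b \<in> conc I Z" "?b \<in> W"
        using wit_ex[OF a(1)] W_wit[OF a(2) S] by auto
      then have "(u, g ?b) \<in> rint J r" using a
        by (auto simp: J_def simp del: wit.simps intro!: image_eqI[of _ _ "(a, ?b)"])
      moreover have "g ?b \<in> conc J Z" unfolding IH using b by blast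
      ultimately show "u \<in> conc J (Ex r Z)" unfolding conc.simps by blast
    qed
  qed
  have chainJ: "chain J rs \<subseteq> map_prod g g ` (chain I rs \<inter> W \<times> W)" for rs
  proof (induction rs)
    case Nil
    then show ?case using W_Delta by (auto simp: J_def Id_on_def image_iff)
  next
    case (Cons r rs)
    show ?case
    proof (clarify)
      fix u w assume "(u, w) \<in> chain J (r # rs)"
      then obtain t where t: "(u, t) \<in> rint J r" "(t, w) \<in> chain J rs" by auto
      obtain a b where ab: "(a, b) \<in> rint I r" "a \<in> W" "b \<in> W" "u = g a" "t = g b"
        using t(1) by (auto simp: J_def)
      obtain b' c where bc: "(b', c) \<in> chain I rs" "b' \<in> W" "c \<in> W" "t = g b'" "w = g c"
        using t(2) Cons by auto
      have "b' = b" using ab bc g by (auto simp: inj_on_def)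
      then have "(a, c) \<in> chain I (r # rs)" using ab bc by auto
      then show "(u, w) \<in> map_prod g g ` (chain I (r # rs) \<inter> W \<times> W)"
        using ab bc by (auto intro!: image_eqI[of _ _ "(a, c)"] simp del: chain.simps)
    qed
  qed
  have "is_interp J" using xW by (auto simp: is_interp_def J_def)
  moreover have "satisfies J a" if "a \<in> T" for a
  proof -
    have sat: "satisfies I a" using I that by (simp add: is_model_def)
    show ?thesis
    proof (cases a)
      case (GCI U V)
      have "axiom_subconcepts a \<subseteq> S" using that by (auto simp: S_def)
      then have "conc J U = g ` (conc I U \<inter> W)" "conc J V = g ` (conc I V \<inter> W)"
        using GCI concJ by auto
      moreover have "conc I U \<subseteq> conc I V" using sat GCI by simp
      ultimately show ?thesis using GCI by auto
    next
      case (RI rs s)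
      have "chain I rs \<subseteq> rint I s" using sat RI by simp
      then have "map_prod g g ` (chain I rs \<inter> W \<times> W) \<subseteq> rint J s" by (auto simp: J_def)
      then show ?thesis using RI chainJ[of rs] by simp
    qed
  qed
  ultimately have "is_model J T" by (simp add: is_model_def)
  then have "conc J X \<subseteq> conc J Y" using sub by (simp add: subsumed_def)
  moreover have "conc J X = g ` (conc I X \<inter> W)" "conc J Y = g ` (conc I Y \<inter> W)"
    by (auto intro!: concJ simp: S_def)
  ultimately have "g x \<in> g ` (conc I Y \<inter> W)" using x xW by auto
  then show "x \<in> conc I Y" using g xW by (auto simp: inj_on_def)
qed

end

theory Submission
  imports Defs
begin

text \<open>For every \<open>S \<subseteq> T\<close>, the formula for \<open>S\<close> is satisfiable iff \<open>C \<sqsubseteq> D\<close> does not follow from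
  \<open>S\<close>; the theorem then follows from the monotonicity of subsumption.  A countermodel \<open>I\<close> of
  \<open>C \<sqsubseteq> D\<close> yields the valuation ``true in \<open>I\<close>'', because the rules are sound.  Conversely, the
  set \<open>K\<close> of derived assertions selected by a valuation contains \<open>S\<close> and is closed under the
  rules, so the canonical model, whose elements are the atoms of \<open>T\<close> and whose concepts and
  roles are read off \<open>K\<close>, satisfies \<open>S\<close>.\<close>

lemma holds_foldr_PAnd: "holds v (foldr PAnd Fs PTrue) \<longleftrightarrow> (\<forall>F\<in>set Fs. holds v F)"
  by (induction Fs) auto

lemma conc_subset_Delta:
  assumes "is_interp I"
  shows "conc I X \<subseteq> Delta I"
  using assms by (induction X) (auto simp: is_interp_def)

lemma conc_conjuncts: "x \<in> conc I X \<longleftrightarrow> (\<forall>Z\<in>set (conjuncts X). x \<in> conc I Z)"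
  by (induction X) auto

lemma chain_nthE:
  assumes "(x, y) \<in> chain I rs"
  obtains xs where "length xs = Suc (length rs)" "xs ! 0 = x" "xs ! length rs = y"
    "\<And>i. i < length rs \<Longrightarrow> (xs ! i, xs ! Suc i) \<in> rint I (rs ! i)"
  using assms
proof (induction rs arbitrary: x thesis)
  case Nil
  then show ?case by (intro Nil.prems(1)[of "[x]"]) auto
next
  case (Cons r rs)
  from Cons.prems(2) obtain z where z: "(x, z) \<in> rint I r" "(z, y) \<in> chain I rs" by auto
  obtain xs where xs: "length xs = Suc (length rs)" "xs ! 0 = z" "xs ! length rs = y"
    "\<And>i. i < length rs \<Longrightarrow> (xs ! i, xs ! Suc i) \<in> rint I (rs ! i)"
    using Cons.IH[OF _ z(2)] by blast
  show ?case
  proof (rule Cons.prems(1)[of "x # xs"])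
    fix i assume "i < length (r # rs)"
    then show "((x # xs) ! i, (x # xs) ! Suc i) \<in> rint I ((r # rs) ! i)"
      using xs z by (cases i) auto
  qed (use xs in auto)
qed

lemma satisfies_role_rule:
  assumes I: "is_interp I" and len: "length Cs = Suc (length rs)"
    and step: "\<And>i. i < length rs \<Longrightarrow> satisfies I (GCI (Cs ! i) (Ex (rs ! i) (Cs ! Suc i)))"
    and RI: "satisfies I (RI rs s)"
  shows "satisfies I (GCI (Cs ! 0) (Ex s (Cs ! length rs)))"
proof -
  have "\<exists>y. (x, y) \<in> chain I rs \<and> y \<in> conc I (Cs ! length rs)" if "x \<in> conc I (Cs ! 0)" for x
    using that len step
  proof (induction rs arbitrary: Cs x)
    case Nil
    then show ?case using conc_subset_Delta[OF I] by auto
  next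
    case (Cons r rs)
    from Cons.prems(2) obtain B Bs where Cs: "Cs = B # Bs" by (cases Cs) auto
    obtain z where z: "(x, z) \<in> rint I r" "z \<in> conc I (Bs ! 0)"
      using Cons.prems(1) Cons.prems(3)[of 0] Cs by auto
    have "satisfies I (GCI (Bs ! i) (Ex (rs ! i) (Bs ! Suc i)))" if "i < length rs" for i
      using Cons.prems(3)[of "Suc i"] Cs that by auto
    then obtain y where "(z, y) \<in> chain I rs" "y \<in> conc I (Bs ! length rs)"
      using Cons.IH[OF z(2)] Cons.prems(2) Cs by auto
    then show ?case using z Cs by auto
  qed
  then show ?thesis using RI by fastforce
qed

lemma rule_sound:
  assumes "rule T as a" and "is_interp I" and "\<forall>b\<in>set as. satisfies I b"
  shows "satisfies I a"
  using assms
proof (cases rule: rule.cases)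
  case (conj C X D)
  then have "conc I C \<subseteq> conc I X" using assms(3) conc_conjuncts[of _ I X] by fastforce
  then show ?thesis using conj assms(3) by auto
next
  case (role Cs rs s)
  then show ?thesis using assms(2,3) by (auto intro!: satisfies_role_rule simp del: satisfies.simps)
next
  case (ex_right C C' D r)
  then have "conc I C \<subseteq> conc I C'" "conc I C' \<subseteq> conc I (Ex r D)" using assms(3) by simp_all
  then show ?thesis using ex_right by (metis order.trans satisfies.simps(1))
next
  case (ex_left C E C' D r)
  then have "conc I C \<subseteq> conc I (Ex r E)" "conc I E \<subseteq> conc I C'" "conc I (Ex r C') \<subseteq> conc I D"
    using assms(3) by simp_all
  moreover from this(2) have "conc I (Ex r E) \<subseteq> conc I (Ex r C')" by auto
  ultimately show ?thesis using ex_left by (metis order.trans satisfies.simps(1))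
qed

lemma trivial_sound:
  assumes "a \<in> trivial T" and "is_interp I"
  shows "satisfies I a"
  using assms conc_subset_Delta[OF assms(2)] by (auto simp: trivial_def)

lemma countermodel_imp_satisfiable:
  assumes "\<not> subsumed TYPE('d) S C D"
  shows "satisfiable (pinpoint T S C D)"
proof -
  obtain I :: "('d, _, _) interp" where I: "is_model I S" "\<not> conc I C \<subseteq> conc I D"
    using assms by (auto simp: subsumed_def)
  then have int: "is_interp I" by (simp add: is_model_def)
  have sel: "holds (satisfies I) (sel T a) \<longleftrightarrow> satisfies I a" for a
    using trivial_sound[OF _ int] by (auto simp: sel_def)
  show ?thesis unfolding satisfiable_def
  proof (intro exI ballI)
    fix F assume "F \<in> pinpoint T S C D"
    then consider as a where "rule T as a"
        "F = PImp (foldr PAnd (map (sel T) as) PTrue) (sel T a)"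
      | a where "a \<in> S" "F = sel T a" | "F = PNot (sel T (GCI C D))"
      by (auto simp: pinpoint_def phi_all_def)
    then show "holds (satisfies I) F"
    proof cases
      case 1
      then show ?thesis using rule_sound[OF 1(1) int] by (simp add: holds_foldr_PAnd sel)
    qed (use I in \<open>auto simp: sel is_model_def\<close>)
  qed
qed

definition canonical ::
  "('c, 'r) axiom set \<Rightarrow> ('c, 'r) axiom set \<Rightarrow> (('c, 'r) concept, 'c, 'r) interp" where
  "canonical T K =
     \<lparr>Delta = atoms T, cint = (\<lambda>A. {X \<in> atoms T. GCI X (Name A) \<in> K}),
      rint = (\<lambda>r. {(X, Y) \<in> atoms T \<times> atoms T. GCI X (Ex r Y) \<in> K})\<rparr>"

lemma is_interp_canonical: "is_interp (canonical T K)"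
  by (auto simp: is_interp_def canonical_def atoms_def)

lemma mem_conc_canonical_atom:
  assumes "trivial T \<subseteq> K" and "is_atom Z"
  shows "X \<in> conc (canonical T K) Z \<longleftrightarrow> X \<in> atoms T \<and> GCI X Z \<in> K"
  using assms by (auto simp: is_atom_def canonical_def trivial_def)

lemma mem_rint_canonical:
  "(X, Y) \<in> rint (canonical T K) r \<longleftrightarrow> X \<in> atoms T \<and> Y \<in> atoms T \<and> GCI X (Ex r Y) \<in> K"
  by (simp add: canonical_def)

lemma atoms_GCI:
  assumes "GCI X Y \<in> T"
  shows "is_atom X \<Longrightarrow> X \<in> atoms T" "is_atom Y \<Longrightarrow> Y \<in> atoms T"
    "X = Ex r Z \<Longrightarrow> is_atom Z \<Longrightarrow> Z \<in> atoms T" "Y = Ex r Z \<Longrightarrow> is_atom Z \<Longrightarrow> Z \<in> atoms T"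
proof -
  have "Name ` names_axiom (GCI X Y) \<subseteq> atoms T" using assms unfolding atoms_def by blast
  moreover have "Top \<in> atoms T" by (simp add: atoms_def)
  ultimately show "is_atom X \<Longrightarrow> X \<in> atoms T" "is_atom Y \<Longrightarrow> Y \<in> atoms T"
    "X = Ex r Z \<Longrightarrow> is_atom Z \<Longrightarrow> Z \<in> atoms T" "Y = Ex r Z \<Longrightarrow> is_atom Z \<Longrightarrow> Z \<in> atoms T"
    by (auto simp: is_atom_def)
qed

lemma canonical_satisfies:
  assumes triv: "trivial T \<subseteq> K" and closed: "\<And>as a. rule T as a \<Longrightarrow> set as \<subseteq> K \<Longrightarrow> a \<in> K"
    and ax: "ax \<in> T" "ax \<in> K" "normal_axiom ax"
  shows "satisfies (canonical T K) ax"
proof (cases ax)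
  case (GCI X Y)
  note atom = mem_conc_canonical_atom[OF triv]
  note inT = atoms_GCI[OF ax(1)[unfolded GCI]]
  consider "atom_conj X" "is_atom Y"
    | r D where "is_atom X" "is_atom D" "Y = Ex r D"
    | r C where "is_atom C" "X = Ex r C" "is_atom Y"
    using ax(3) GCI by auto
  then have "x \<in> conc (canonical T K) Y" if x: "x \<in> conc (canonical T K) X" for x
  proof cases
    case 1
    have xT: "x \<in> atoms T"
      using x conc_subset_Delta[OF is_interp_canonical, of T K X] by (auto simp: canonical_def)
    have "\<forall>Z\<in>set (conjuncts X). GCI x Z \<in> K"
      using x 1 conc_conjuncts[of x "canonical T K" X] atom by (auto simp: atom_conj_def)
    then have "GCI x Y \<in> K"
      using closed[OF rule.conj[OF xT ax(1)[unfolded GCI] 1]] ax(2) GCI by auto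
    then show ?thesis using atom[OF 1(2)] xT by simp
  next
    case 2
    have xX: "x \<in> atoms T" "GCI x X \<in> K" using x atom[OF 2(1)] by auto
    have D: "D \<in> atoms T" using inT 2 by blast
    have "GCI x (Ex r D) \<in> K"
      using closed[OF rule.ex_right[of x T X D r]] xX D inT(1) 2 ax GCI by auto
    moreover have "D \<in> conc (canonical T K) D"
      using atom[OF 2(2)] D triv by (auto simp: trivial_def)
    ultimately show ?thesis using 2 xX D by (auto simp: mem_rint_canonical)
  next
    case 3
    obtain y where y: "x \<in> atoms T" "y \<in> atoms T" "GCI x (Ex r y) \<in> K" "GCI y C \<in> K"
      using x 3 atom[OF 3(1)] by (auto simp: mem_rint_canonical)
    have "C \<in> atoms T" "Y \<in> atoms T" using inT 3 by blast+
    then have "GCI x Y \<in> K"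
      using closed[OF rule.ex_left[of x T y C Y r]] y 3 ax GCI by auto
    then show ?thesis using atom[OF 3(3)] y by simp
  qed
  then show ?thesis using GCI by auto
next
  case (RI rs s)
  have "(x, y) \<in> rint (canonical T K) s" if xy: "(x, y) \<in> chain (canonical T K) rs" for x y
  proof -
    obtain xs where xs: "length xs = Suc (length rs)" "xs ! 0 = x" "xs ! length rs = y"
      "\<And>i. i < length rs \<Longrightarrow> (xs ! i, xs ! Suc i) \<in> rint (canonical T K) (rs ! i)"
      using chain_nthE[OF xy] by blast
    have "rs \<noteq> []" using ax(3) RI by simp
    have "xs ! i \<in> atoms T" if "i \<le> length rs" for i
    proof (cases "i < length rs")
      case True
      then show ?thesis using xs(4) by (simp add: mem_rint_canonical)
    next
      case False
      then show ?thesis using that \<open>rs \<noteq> []\<close> xs(4)[of "length rs - 1"]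
        by (auto simp: mem_rint_canonical)
    qed
    then have sub: "set xs \<subseteq> atoms T" using xs(1) by (auto simp: in_set_conv_nth)
    have "GCI (xs ! 0) (Ex s (xs ! length rs)) \<in> K"
      using xs(4) ax RI by (intro closed[OF rule.role[OF xs(1) sub]]) (auto simp: mem_rint_canonical)
    moreover have "xs ! 0 \<in> atoms T" "xs ! length rs \<in> atoms T" using sub xs(1) by auto
    ultimately show ?thesis using xs by (simp add: mem_rint_canonical)
  qed
  then show ?thesis using RI by auto
qed

lemma satisfiable_imp_countermodel:
  fixes T S :: "('c, 'r) axiom set"
  assumes inf: "infinite (UNIV :: 'd set)" and T: "normal_TBox T" and S: "S \<subseteq> T"
    and C: "C \<in> atoms T" and D: "D \<in> atoms T" and sat: "satisfiable (pinpoint T S C D)"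
  shows "\<not> subsumed TYPE('d) S C D"
proof
  assume sub: "subsumed TYPE('d) S C D"
  obtain v where v: "\<And>F. F \<in> pinpoint T S C D \<Longrightarrow> holds v F"
    using sat by (auto simp: satisfiable_def)
  \<comment> \<open>\<open>v\<close> is unconstrained on axioms that are not derived, hence the restriction.\<close>
  define K where "K = {a \<in> derived T. holds v (sel T a)}"
  have triv: "trivial T \<subseteq> K" by (auto simp: K_def sel_def intro: derived.intros)
  have closed: "a \<in> K" if "rule T as a" "set as \<subseteq> K" for as a
  proof -
    have "PImp (foldr PAnd (map (sel T) as) PTrue) (sel T a) \<in> pinpoint T S C D"
      using that by (auto simp: pinpoint_def phi_all_def K_def)
    from v[OF this] have "holds v (sel T a)"
      using that(2) by (auto simp: holds_foldr_PAnd K_def)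
    moreover have "a \<in> derived T"
      using that by (auto simp: K_def intro: derived.intros)
    ultimately show ?thesis by (simp add: K_def)
  qed
  have SK: "S \<subseteq> K" using v S by (auto simp: K_def pinpoint_def intro: derived.intros)
  have "satisfies (canonical T K) a" if "a \<in> S" for a
    using canonical_satisfies[OF triv, of a] closed that S SK T
    unfolding normal_TBox_def by blast
  then have "is_model (canonical T K) S" by (simp add: is_model_def is_interp_canonical)
  moreover have "finite S" using S T finite_subset by (auto simp: normal_TBox_def)
  ultimately have "conc (canonical T K) C \<subseteq> conc (canonical T K) D"
    using subsumed_any_domain[OF inf _ sub] by blast
  moreover have "is_atom C" "is_atom D" using C D by (auto simp: atoms_def is_atom_def)
  moreover have "GCI C C \<in> K" using triv C by (auto simp: trivial_def)
  ultimately have "GCI C D \<in> K" using C mem_conc_canonical_atom[OF triv] by blast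
  moreover have "\<not> holds v (sel T (GCI C D))"
    using v[of "PNot (sel T (GCI C D))"] by (simp add: pinpoint_def)
  ultimately show False by (simp add: K_def)
qed

lemma subsumed_mono: "subsumed d S X Y \<Longrightarrow> S \<subseteq> S' \<Longrightarrow> subsumed d S' X Y"
  by (auto simp: subsumed_def is_model_def)

lemma is_MinA_iff_remove:
  "is_MinA d S X Y \<longleftrightarrow> subsumed d S X Y \<and> (\<forall>a\<in>S. \<not> subsumed d (S - {a}) X Y)"
proof
  assume "is_MinA d S X Y"
  then show "subsumed d S X Y \<and> (\<forall>a\<in>S. \<not> subsumed d (S - {a}) X Y)"
    by (auto simp: is_MinA_def)
next
  assume *: "subsumed d S X Y \<and> (\<forall>a\<in>S. \<not> subsumed d (S - {a}) X Y)"
  have "\<not> subsumed d S' X Y" if "S' \<subset> S" for S'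
  proof -
    from that obtain a where "a \<in> S" "S' \<subseteq> S - {a}" by blast
    then show ?thesis using * subsumed_mono by blast
  qed
  then show "is_MinA d S X Y" using * by (simp add: is_MinA_def)
qed

theorem theorem4:
  fixes T T' :: "('c, 'r) axiom set" and C D :: "('c, 'r) concept"
  assumes "infinite (UNIV :: 'd set)"
    and "normal_TBox T"
    and "T' \<subseteq> T"
    and "C \<in> atoms T" and "D \<in> atoms T"
  shows "is_MinA TYPE('d) T' C D \<longleftrightarrow> pinpoint_min_unsat T T' C D"
proof -
  have "satisfiable (pinpoint T S C D) \<longleftrightarrow> \<not> subsumed TYPE('d) S C D" if "S \<subseteq> T'" for S
    using satisfiable_imp_countermodel[OF assms(1,2) order.trans[OF that assms(3)] assms(4,5)]
      countermodel_imp_satisfiable[where 'd = 'd, of S C D T] by argo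
  then show ?thesis by (simp add: is_MinA_iff_remove pinpoint_min_unsat_def Diff_subset)
qed

end
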